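(* Let $0<a<b<\infty$, $\alpha>0$, $\rho>0$, and let $f:[a,b]\to\mathbb{R}$ be a convex function with $f\in L[a,b]$. Put $F(x)=f(x)+f(a+b-x)$ for $x\in[a,b]$. Then $F$ is also integrable, and $$ F\Big(\frac{a+b}{2}\Big)\leq \frac{\rho^\alpha \Gamma(\alpha+1)}{2(b^\rho-a^\rho)^\alpha}\left[ {}^\rho I^\alpha_{a+}F(b)+ {}^\rho I^\alpha_{b-}F(a)\right] \leq \frac{F(a)+F(b)}{2}. $$
   Context: The left- and right-sided Katugampola fractional integrals of order $\alpha>0$ with parameter $\rho>0$ are $$ {}^\rho I^\alpha_{a+}h(x)=\frac{\rho^{1-\alpha}}{\Gamma(\alpha)}\int_a^x\frac{t^{\rho-1}}{(x^\rho-t^\rho)^{1-\alpha}}h(t)\,dt,\qquad {}^\rho I^\alpha_{b-}h(x)=\frac{\rho^{1-\alpha}}{\Gamma(\alpha)}\int_x^b\frac{t^{\rho-1}}{(t^\rho-x^\rho)^{1-\alpha}}h(t)\,dt,$$ when the integrals exist; ${}^\rho I^\alpha_{a+}h(b)$ and ${}^\rho I^\alpha_{b-}h(a)$ denote their values at $x=b$ and $x=a$ respectively. $\Gamma$ is Euler's gamma function and $L[a,b]$ is the space of Lebesgue integrable functions on $[a,b]$. *)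

theory Defs
  imports "HOL-Analysis.Analysis"
begin

text \<open>
  Katugampola fractional integrals of order \<open>\<alpha>\<close> with parameter \<open>\<rho>\<close>, as Lebesgue integrals.
  They are only meant for \<open>0 < a\<close>, where \<open>powr\<close> is the usual real power on the range of
  integration. At the endpoint \<open>t = x\<close> the kernels take the value 0 (\<open>0 powr _ = 0\<close> and
  division by zero), which does not affect the integrals. As the Bochner integral of a
  non-integrable function is 0, the existence of the integrals is expressed by the separate
  \<open>_exists\<close> predicates.
\<close>

definition katugampola_left_kernel :: "real \<Rightarrow> real \<Rightarrow> real \<Rightarrow> real \<Rightarrow> real" where
  "katugampola_left_kernel \<rho> \<alpha> x t = t powr (\<rho> - 1) / (x powr \<rho> - t powr \<rho>) powr (1 - \<alpha>)"

definition katugampola_right_kernel :: "real \<Rightarrow> real \<Rightarrow> real \<Rightarrow> real \<Rightarrow> real" where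
  "katugampola_right_kernel \<rho> \<alpha> x t = t powr (\<rho> - 1) / (t powr \<rho> - x powr \<rho>) powr (1 - \<alpha>)"

definition katugampola_left_exists ::
    "real \<Rightarrow> real \<Rightarrow> real \<Rightarrow> (real \<Rightarrow> real) \<Rightarrow> real \<Rightarrow> bool" where
  "katugampola_left_exists \<rho> \<alpha> a h x \<longleftrightarrow>
     (\<lambda>t. katugampola_left_kernel \<rho> \<alpha> x t * h t) absolutely_integrable_on {a..x}"

definition katugampola_right_exists ::
    "real \<Rightarrow> real \<Rightarrow> real \<Rightarrow> (real \<Rightarrow> real) \<Rightarrow> real \<Rightarrow> bool" where
  "katugampola_right_exists \<rho> \<alpha> b h x \<longleftrightarrow>
     (\<lambda>t. katugampola_right_kernel \<rho> \<alpha> x t * h t) absolutely_integrable_on {x..b}"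

definition katugampola_left ::
    "real \<Rightarrow> real \<Rightarrow> real \<Rightarrow> (real \<Rightarrow> real) \<Rightarrow> real \<Rightarrow> real" where
  "katugampola_left \<rho> \<alpha> a h x =
     \<rho> powr (1 - \<alpha>) / Gamma \<alpha> *
     (LINT t:{a..x}|lebesgue. katugampola_left_kernel \<rho> \<alpha> x t * h t)"

definition katugampola_right ::
    "real \<Rightarrow> real \<Rightarrow> real \<Rightarrow> (real \<Rightarrow> real) \<Rightarrow> real \<Rightarrow> real" where
  "katugampola_right \<rho> \<alpha> b h x =
     \<rho> powr (1 - \<alpha>) / Gamma \<alpha> *
     (LINT t:{x..b}|lebesgue. katugampola_right_kernel \<rho> \<alpha> x t * h t)"

end

(* By convexity F lies between F((a+b)/2) = 2 f((a+b)/2) and F(a) = F(b) = f(a) + f(b) on all of [a,b].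
   Both kernels are nonnegative with elementary primitives and have total mass (b^\<rho> - a^\<rho>)^\<alpha> / (\<rho> \<alpha>),
   so the normalised expression in the middle is a weighted average of F. *)
theory Submission
  imports Defs
begin

text \<open>The map x \<mapsto> a + b - x is affine with factor -1 and carries the interval onto
  itself. This is what makes \<open>F\<close> inherit integrability from \<open>f\<close>.\<close>

lemma absolutely_integrable_reflect_midpoint:
  fixes f :: "real \<Rightarrow> real"
  assumes "f absolutely_integrable_on {a..b}"
  shows "(\<lambda>x. f (a + b - x)) absolutely_integrable_on {a..b}"
proof -
  have *: "(\<lambda>x. g (a + b - x)) integrable_on {a..b}" if "g integrable_on {a..b}" for g :: "real \<Rightarrow> real"
  proof -
    have "(\<lambda>x. g ((-1) *\<^sub>R x + (a + b))) integrable_on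
        ((\<lambda>x. (1 / (-1)) *\<^sub>R x + - ((1 / (-1)) *\<^sub>R (a + b))) ` cbox a b)"
      using that by (intro integrable_affinity) auto
    moreover have "((\<lambda>x. (1 / (-1)) *\<^sub>R x + - ((1 / (-1)) *\<^sub>R (a + b))) ` cbox a b) = {a..b}"
      using image_diff_atLeastAtMost[of "a + b" a b] by simp
    ultimately show ?thesis by simp
  qed
  \<comment> \<open>Absolute integrability means integrability of both \<open>f\<close> and its
    norm, so the reflection is applied to each.\<close>
  show ?thesis
    using assms *[of f] *[of "\<lambda>x. norm (f x)"] by (simp add: absolutely_integrable_on_def)
qed

text \<open>Lower bound: (a + b) / 2 is the midpoint of \<open>x\<close> and its reflection. Upper
  bound: \<open>x\<close> and its reflection are convex combinations of \<open>a\<close> and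
  \<open>b\<close> with swapped weights, so the two chord estimates add up to f a + f b.\<close>

lemma convex_on_reflect_sum_bounds:
  fixes f :: "real \<Rightarrow> real"
  assumes "convex_on {a..b} f" and "x \<in> {a..b}"
  shows "2 * f ((a + b) / 2) \<le> f x + f (a + b - x)"
    and "f x + f (a + b - x) \<le> f a + f b"
proof -
  have "f ((1 - 1/2) *\<^sub>R x + (1/2) *\<^sub>R (a + b - x)) \<le> (1 - 1/2) * f x + 1/2 * f (a + b - x)"
    using assms by (intro convex_onD[OF assms(1)]) auto
  moreover have "(1 - 1/2) *\<^sub>R x + (1/2) *\<^sub>R (a + b - x) = (a + b) / 2"
    by (simp add: add_divide_distrib diff_divide_distrib)
  ultimately have "f ((a + b) / 2) \<le> (1 - 1/2) * f x + 1/2 * f (a + b - x)"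
    by (simp only:)
  then show "2 * f ((a + b) / 2) \<le> f x + f (a + b - x)"
    by simp
  show "f x + f (a + b - x) \<le> f a + f b"
  proof (cases "a = b")
    case True
    with assms(2) show ?thesis by simp
  next
    case False
    \<comment> \<open>\<open>u\<close> is the weight of \<open>b\<close> in \<open>x\<close>; the
      division is why the degenerate interval was split off.\<close>
    define u where "u = (x - a) / (b - a)"
    have u: "0 \<le> u" "u \<le> 1" and x: "x = a + u * (b - a)"
      using False assms(2) by (auto simp: u_def divide_simps)
    have "f ((1 - u) *\<^sub>R a + u *\<^sub>R b) \<le> (1 - u) * f a + u * f b"
      and "f ((1 - u) *\<^sub>R b + u *\<^sub>R a) \<le> (1 - u) * f b + u * f a"
      using assms u by (intro convex_onD[OF assms(1)]; simp)+
    moreover have "(1 - u) *\<^sub>R a + u *\<^sub>R b = x" "(1 - u) *\<^sub>R b + u *\<^sub>R a = a + b - x"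
      by (simp_all add: x algebra_simps)
    ultimately have "f x \<le> (1 - u) * f a + u * f b" "f (a + b - x) \<le> (1 - u) * f b + u * f a"
      by (simp_all only:)
    then show ?thesis by (simp add: algebra_simps)
  qed
qed

lemma katugampola_left_kernel_nonneg: "0 \<le> katugampola_left_kernel \<rho> \<alpha> x t"
  by (simp add: katugampola_left_kernel_def)

lemma katugampola_right_kernel_nonneg: "0 \<le> katugampola_right_kernel \<rho> \<alpha> x t"
  by (simp add: katugampola_right_kernel_def)

text \<open>The kernel is the derivative of \<open>?G\<close>, which vanishes at \<open>b\<close>,
  so the total mass is - \<open>?G a\<close>.\<close>

lemma has_integral_katugampola_left_kernel:
  assumes "0 < a" "a \<le> b" "0 < \<alpha>" "0 < \<rho>"
  shows "(katugampola_left_kernel \<rho> \<alpha> b has_integral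
    (b powr \<rho> - a powr \<rho>) powr \<alpha> / (\<rho> * \<alpha>)) {a..b}"
proof -
  let ?G = "\<lambda>t. - ((b powr \<rho> - t powr \<rho>) powr \<alpha> / (\<rho> * \<alpha>))"
  have "(katugampola_left_kernel \<rho> \<alpha> b has_integral (?G b - ?G a)) {a..b}"
  \<comment> \<open>For \<alpha> < 1 the kernel blows up as t approaches b. The interior version
    asks for the derivative on the open interval only, plus continuity of \<open>?G\<close> up to
    the endpoints; at t = b the base of the power is 0 and continuity rests on \<alpha> > 0.\<close>
  proof (rule fundamental_theorem_of_calculus_interior)
    show "continuous_on {a..b} ?G"
      using assms by (intro continuous_intros continuous_on_powr') (auto intro!: powr_mono2)
    fix t assume t: "t \<in> {a<..<b}"
    then have pos: "0 < t" "0 < b powr \<rho> - t powr \<rho>"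
      using assms by (auto intro!: powr_less_mono2)
    have "(?G has_real_derivative katugampola_left_kernel \<rho> \<alpha> b t) (at t)"
      using pos assms
      by (auto intro!: derivative_eq_intros simp: katugampola_left_kernel_def powr_diff field_simps)
    then show "(?G has_vector_derivative katugampola_left_kernel \<rho> \<alpha> b t) (at t)"
      by (simp add: has_real_derivative_iff_has_vector_derivative)
  qed (use assms in auto)
  then show ?thesis using assms by simp
qed

text \<open>Mirror image of the left kernel: the possible singularity and the zero of the primitive
  now sit at \<open>a\<close>, and the mass is the same.\<close>

lemma has_integral_katugampola_right_kernel:
  assumes "0 < a" "a \<le> b" "0 < \<alpha>" "0 < \<rho>"
  shows "(katugampola_right_kernel \<rho> \<alpha> a has_integral
    (b powr \<rho> - a powr \<rho>) powr \<alpha> / (\<rho> * \<alpha>)) {a..b}"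
proof -
  let ?G = "\<lambda>t. (t powr \<rho> - a powr \<rho>) powr \<alpha> / (\<rho> * \<alpha>)"
  have "(katugampola_right_kernel \<rho> \<alpha> a has_integral (?G b - ?G a)) {a..b}"
  proof (rule fundamental_theorem_of_calculus_interior)
    show "continuous_on {a..b} ?G"
      using assms by (intro continuous_intros continuous_on_powr') (auto intro!: powr_mono2)
    fix t assume t: "t \<in> {a<..<b}"
    then have pos: "0 < t" "0 < t powr \<rho> - a powr \<rho>"
      using assms by (auto intro!: powr_less_mono2)
    have "(?G has_real_derivative katugampola_right_kernel \<rho> \<alpha> a t) (at t)"
      using pos assms
      by (auto intro!: derivative_eq_intros simp: katugampola_right_kernel_def powr_diff field_simps)
    then show "(?G has_vector_derivative katugampola_right_kernel \<rho> \<alpha> a t) (at t)"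
      by (simp add: has_real_derivative_iff_has_vector_derivative)
  qed (use assms in auto)
  then show ?thesis using assms by simp
qed

text \<open>The weight may be unbounded, but it is integrable and \<open>g\<close> is measurable and
  bounded, so the product is absolutely integrable; then m * w \<le> w * g \<le> M * w is
  integrated. With a kernel as \<open>w\<close>, the first claim is the existence of the fractional
  integral.\<close>

lemma weighted_integral_bounds:
  fixes w g :: "real \<Rightarrow> real"
  assumes w: "(w has_integral W) {a..b}" "\<And>t. t \<in> {a..b} \<Longrightarrow> 0 \<le> w t"
    and g: "g absolutely_integrable_on {a..b}" "\<And>t. t \<in> {a..b} \<Longrightarrow> m \<le> g t \<and> g t \<le> M"
  shows "(\<lambda>t. w t * g t) absolutely_integrable_on {a..b}"
    and "m * W \<le> (LINT t:{a..b}|lebesgue. w t * g t)"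
    and "(LINT t:{a..b}|lebesgue. w t * g t) \<le> M * W"
proof -
  have "w absolutely_integrable_on {a..b}"
    using w by (intro nonnegative_absolutely_integrable_1) auto
  moreover have "g \<in> borel_measurable (lebesgue_on {a..b})"
    using g(1) by (intro absolutely_integrable_imp_borel_measurable) auto
  moreover have "bounded (g ` {a..b})"
    using g(2) by (intro bounded_subset[OF bounded_closed_interval[of m M]]) auto
  ultimately have "(\<lambda>t. g t * w t) absolutely_integrable_on {a..b}"
    by (intro absolutely_integrable_bounded_measurable_product_real) auto
  then show wg: "(\<lambda>t. w t * g t) absolutely_integrable_on {a..b}"
    by (simp add: mult.commute)
  \<comment> \<open>The Lebesgue integral is restated through \<open>has_integral\<close>, the form
    in which the mass of \<open>w\<close> is given.\<close>
  have int: "((\<lambda>t. w t * g t) has_integral (LINT t:{a..b}|lebesgue. w t * g t)) {a..b}"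
    using set_lebesgue_integral_eq_integral[OF wg] by (simp add: integrable_integral)
  show "m * W \<le> (LINT t:{a..b}|lebesgue. w t * g t)"
    by (rule has_integral_le[OF has_integral_mult_right[OF w(1)] int])
       (use w(2) g(2) in \<open>simp add: mult.commute[of m] mult_left_mono\<close>)
  show "(LINT t:{a..b}|lebesgue. w t * g t) \<le> M * W"
    by (rule has_integral_le[OF int has_integral_mult_right[OF w(1)]])
       (use w(2) g(2) in \<open>simp add: mult.commute[of M] mult_left_mono\<close>)
qed

theorem theorem3p1:
  fixes a b \<alpha> \<rho> :: real and f F :: "real \<Rightarrow> real"
  assumes "0 < a" and "a < b" and "\<alpha> > 0" and "\<rho> > 0"
    and "convex_on {a..b} f"
    and "f absolutely_integrable_on {a..b}"
    and "\<And>x. x \<in> {a..b} \<Longrightarrow> F x = f x + f (a + b - x)"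
  shows "F absolutely_integrable_on {a..b}
    \<and> katugampola_left_exists \<rho> \<alpha> a F b
    \<and> katugampola_right_exists \<rho> \<alpha> b F a
    \<and> F ((a + b) / 2)
        \<le> \<rho> powr \<alpha> * Gamma (\<alpha> + 1) / (2 * (b powr \<rho> - a powr \<rho>) powr \<alpha>)
            * (katugampola_left \<rho> \<alpha> a F b + katugampola_right \<rho> \<alpha> b F a)
    \<and> \<rho> powr \<alpha> * Gamma (\<alpha> + 1) / (2 * (b powr \<rho> - a powr \<rho>) powr \<alpha>)
            * (katugampola_left \<rho> \<alpha> a F b + katugampola_right \<rho> \<alpha> b F a)
        \<le> (F a + F b) / 2"
proof -
  define D where "D = b powr \<rho> - a powr \<rho>"
  define W where "W = D powr \<alpha> / (\<rho> * \<alpha>)"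
  define m where "m = F ((a + b) / 2)"
  define M where "M = (F a + F b) / 2"
  define C where "C = \<rho> powr \<alpha> * Gamma (\<alpha> + 1) / (2 * D powr \<alpha>)"
  define c where "c = \<rho> powr (1 - \<alpha>) / Gamma \<alpha>"
  define L where "L = (LINT t:{a..b}|lebesgue. katugampola_left_kernel \<rho> \<alpha> b t * F t)"
  define R where "R = (LINT t:{a..b}|lebesgue. katugampola_right_kernel \<rho> \<alpha> a t * F t)"
  have F_eq: "F x = f x + f (a + b - x)" if "x \<in> {a..b}" for x
    using assms(7) that .
  have "D > 0"
    using assms by (auto simp: D_def intro!: powr_less_mono2)
  then have "W > 0"
    using assms by (simp add: W_def)
  have Gam: "Gamma \<alpha> \<noteq> 0" "Gamma (\<alpha> + 1) = \<alpha> * Gamma \<alpha>"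
    using Gamma_real_pos[OF assms(3)] Gamma_plus1[of \<alpha>] assms(3) nonpos_Ints_nonpos[of \<alpha>]
    by linarith+
  \<comment> \<open>The powers of \<rho> multiply to \<rho>, the Gamma quotient is \<alpha>, and D
    powr \<alpha> cancels against \<open>W\<close>. Thus \<open>C * c\<close> is the reciprocal of
    the combined mass of both kernels.\<close>
  have Cc: "C * c * (2 * W) = 1"
    using assms Gam \<open>D > 0\<close> by (simp add: C_def c_def W_def powr_diff)
  have Cc': "C * c = 1 / (2 * W)"
    using Cc \<open>W > 0\<close> by (simp add: field_simps)
  have "(\<lambda>x. f x + f (a + b - x)) absolutely_integrable_on {a..b}"
    using assms by (intro set_integral_add absolutely_integrable_reflect_midpoint) auto
  \<comment> \<open>\<open>F\<close> is prescribed only on [a, b], so integrability is transferred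
    by agreement there, with empty exceptional set.\<close>
  then have F_int: "F absolutely_integrable_on {a..b}"
    by (rule absolutely_integrable_spike[where S = "{}"]) (auto simp: F_eq)
  have F_bd: "m \<le> F t \<and> F t \<le> M" if "t \<in> {a..b}" for t
    using convex_on_reflect_sum_bounds[OF assms(5) that] F_eq[OF that] F_eq[of a] F_eq[of b]
      F_eq[of "(a + b) / 2"] assms(2)
    by (simp add: m_def M_def field_simps)
  have wl: "(katugampola_left_kernel \<rho> \<alpha> b has_integral W) {a..b}"
    unfolding W_def D_def using assms by (intro has_integral_katugampola_left_kernel) auto
  have wr: "(katugampola_right_kernel \<rho> \<alpha> a has_integral W) {a..b}"
    unfolding W_def D_def using assms by (intro has_integral_katugampola_right_kernel) auto
  note l = weighted_integral_bounds[OF wl katugampola_left_kernel_nonneg F_int F_bd]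
  note r = weighted_integral_bounds[OF wr katugampola_right_kernel_nonneg F_int F_bd]
  have "C * (katugampola_left \<rho> \<alpha> a F b + katugampola_right \<rho> \<alpha> b F a) = C * c * (L + R)"
    by (simp add: katugampola_left_def katugampola_right_def c_def L_def R_def algebra_simps)
  also have "\<dots> = (L + R) / (2 * W)"
    by (simp add: Cc')
  finally have eq: "C * (katugampola_left \<rho> \<alpha> a F b + katugampola_right \<rho> \<alpha> b F a) = (L + R) / (2 * W)" .
  \<comment> \<open>Both \<open>L\<close> and \<open>R\<close> lie between \<open>m * W\<close> and
    \<open>M * W\<close>; add and divide by 2 * W > 0.\<close>
  have "m \<le> (L + R) / (2 * W)" "(L + R) / (2 * W) \<le> M"
    using l(2,3) r(2,3) \<open>W > 0\<close> by (simp_all add: L_def R_def field_simps)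
  then show ?thesis
    using F_int l(1) r(1)
    unfolding katugampola_left_exists_def katugampola_right_exists_def
      eq[unfolded C_def D_def] m_def M_def
    by blast
qed

end
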